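(* Let $X=\{f=0\}\subset\mathbb{C}^3$ with $f=z^2+y^3+x^5$ (the $E_8$ singularity), and let $W$ be the following set of weight vectors: $$(1,1,1),(1,1,2),(1,2,2),(1,2,3),(2,2,3),(2,3,4),(2,3,5),(2,4,5),(3,4,6),(3,5,7),(3,5,8),$$ $$(4,6,8),(4,6,9),(4,7,10),(5,7,11),(5,8,11),(5,8,12),(5,9,13),(5,9,14),(6,10,14),(6,10,15).$$ The weight vectors give a toric embedded resolution of $X\subset\mathbb{C}^3$, i.e. there is a regular subdivision $\Sigma$ of the Newton dual fan $\Gamma(f)$ whose one-dimensional cones are exactly those spanned by $e_1,e_2,e_3$ and by the elements of $W$; but this resolution is not minimal.
   Context: $\Gamma(f)$ is the fan subdividing $\mathbb{R}_{\ge0}^3$ dual to the Newton polyhedron $NP^+(f)=\mathrm{conv}\bigcup_{c_i\neq0}(i+\mathbb{R}_{\ge0}^3)$ of $f=\sum c_i x^{i_1}y^{i_2}z^{i_3}$: two covectors in $\mathbb{R}_{\ge0}^3$ lie in the relative interior of the same cone iff they attain their minimum on $NP^+(f)$ along the same face. $e_1,e_2,e_3$ is the standard basis of $\mathbb{Z}^3$. A fan is regular if each cone is generated by part of a basis of $\mathbb{Z}^3$. (An element of $W$ need not be primitive; it spans the ray of its primitive multiple.) For a regular subdivision $\Sigma$ of $\Gamma(f)$, the induced proper birational toric morphism $\mu_\Sigma:Z_\Sigma\to\mathbb{C}^3$ is an embedded resolution of $X\subset\mathbb{C}^3$, because $f$ is Newton non-degenerate; these are what we call toric embedded resolutions. For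 a strongly convex rational cone $\sigma$, $G_\sigma$ is the set of $x\in\sigma\cap\mathbb{Z}^3\setminus\{0\}$ such that $x=n_1+n_2$ with $n_1,n_2\in\sigma\cap\mathbb{Z}^3$ implies $n_1=0$ or $n_2=0$. The toric embedded resolution given by $\Sigma$ is minimal if every one-dimensional cone of $\Sigma$ is either a one-dimensional cone of $\Gamma(f)$ or is spanned by an element of $G_\sigma$ for some maximal-dimensional cone $\sigma\in\Gamma(f)$. *)

theory Defs
  imports "HOL-Analysis.Analysis" "HOL-Library.Poly_Mapping"
begin

section \<open>The lattice of integer vectors\<close>

interpretation int_module: module "\<lambda>(k::int) (v::real^3). of_int k *\<^sub>R v"
  by unfold_locales (simp_all add: algebra_simps)

definition int_lattice :: "(real^3) set" where
  "int_lattice = {v. \<forall>i. v $ i \<in> \<int>}"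

text \<open>Here \<open>independent\<close> and \<open>span\<close> are taken over the integers.\<close>

definition lattice_basis :: "(real^3) set \<Rightarrow> bool" where
  "lattice_basis B \<longleftrightarrow> int_module.independent B \<and> int_module.span B = int_lattice"

section \<open>Cones and fans\<close>

text \<open>The convex cone hull of a set consists of its nonnegative real linear combinations;
  the hull of the empty set is \<open>{0}\<close>.\<close>

definition rational_cone :: "(real^3) set \<Rightarrow> bool" where
  "rational_cone \<sigma> \<longleftrightarrow> (\<exists>S. finite S \<and> S \<subseteq> int_lattice \<and> \<sigma> = convex_cone hull S)"

definition strongly_convex :: "(real^3) set \<Rightarrow> bool" where
  "strongly_convex \<sigma> \<longleftrightarrow> \<sigma> \<inter> uminus ` \<sigma> = {0}"

text \<open>The library relation \<open>face_of\<close> also admits the empty face, which is not a face of a cone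
  in the sense of fans.\<close>

definition is_fan :: "(real^3) set set \<Rightarrow> bool" where
  "is_fan \<Sigma> \<longleftrightarrow> finite \<Sigma> \<and> \<Sigma> \<noteq> {} \<and>
     (\<forall>\<sigma>\<in>\<Sigma>. rational_cone \<sigma> \<and> strongly_convex \<sigma>) \<and>
     (\<forall>\<sigma>\<in>\<Sigma>. \<forall>\<tau>. \<tau> face_of \<sigma> \<and> \<tau> \<noteq> {} \<longrightarrow> \<tau> \<in> \<Sigma>) \<and>
     (\<forall>\<sigma>\<in>\<Sigma>. \<forall>\<tau>\<in>\<Sigma>. (\<sigma> \<inter> \<tau>) face_of \<sigma> \<and> (\<sigma> \<inter> \<tau>) face_of \<tau>)"

definition regular_fan :: "(real^3) set set \<Rightarrow> bool" where
  "regular_fan \<Sigma> \<longleftrightarrow> is_fan \<Sigma> \<and>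
     (\<forall>\<sigma>\<in>\<Sigma>. \<exists>B S. lattice_basis B \<and> S \<subseteq> B \<and> \<sigma> = convex_cone hull S)"

definition subdivides :: "(real^3) set set \<Rightarrow> (real^3) set set \<Rightarrow> bool" where
  "subdivides \<Sigma> \<Gamma> \<longleftrightarrow> \<Union>\<Sigma> = \<Union>\<Gamma> \<and> (\<forall>\<sigma>\<in>\<Sigma>. \<exists>\<tau>\<in>\<Gamma>. \<sigma> \<subseteq> \<tau>)"

text \<open>For Newton non-degenerate \<open>f\<close>, the regular subdivisions of its dual fan are the fans of
  the toric embedded resolutions of \<open>f = 0\<close>; a resolution is identified with its fan.\<close>

definition regular_subdivision :: "(real^3) set set \<Rightarrow> (real^3) set set \<Rightarrow> bool" where
  "regular_subdivision \<Sigma> \<Gamma> \<longleftrightarrow> regular_fan \<Sigma> \<and> subdivides \<Sigma> \<Gamma>"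

definition rays :: "(real^3) set set \<Rightarrow> (real^3) set set" where
  "rays \<Sigma> = {\<rho> \<in> \<Sigma>. dim \<rho> = 1}"

section \<open>Newton polyhedron and dual fan\<close>

text \<open>A polynomial in three variables is the finitely supported family of its coefficients,
  indexed by exponent vectors; \<open>Poly_Mapping.keys f\<close> is its support, and the ring structure is
  convolution.\<close>

type_synonym poly3 = "(nat^3) \<Rightarrow>\<^sub>0 complex"

definition pvar :: "3 \<Rightarrow> poly3" where
  "pvar i = Poly_Mapping.single (axis i 1) 1"

definition orthant :: "(real^3) set" where
  "orthant = {v. \<forall>i. 0 \<le> v $ i}"

definition newton_polyhedron :: "poly3 \<Rightarrow> (real^3) set" where
  "newton_polyhedron f =
     convex hull (\<Union>m\<in>Poly_Mapping.keys f. {(\<chi> i. of_nat (m $ i)) + v | v. v \<in> orthant})"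

definition min_face :: "(real^3) set \<Rightarrow> real^3 \<Rightarrow> (real^3) set" where
  "min_face P u = {p \<in> P. \<forall>q\<in>P. u \<bullet> p \<le> u \<bullet> q}"

text \<open>The relative interiors of the cones of the dual fan are the classes of covectors of the
  orthant with equal minimal face, and a closed convex set is the closure of its relative
  interior.\<close>

definition newton_dual_fan :: "poly3 \<Rightarrow> (real^3) set set" where
  "newton_dual_fan f =
     (\<lambda>w. closure {u \<in> orthant. min_face (newton_polyhedron f) u = min_face (newton_polyhedron f) w})
       ` orthant"

section \<open>Minimality\<close>

text \<open>The set $G_\sigma$ of irreducible nonzero lattice points of a cone.\<close>

definition irreducible_points :: "(real^3) set \<Rightarrow> (real^3) set" where
  "irreducible_points \<sigma> = {x \<in> \<sigma> \<inter> int_lattice - {0}.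
     \<forall>n1 \<in> \<sigma> \<inter> int_lattice. \<forall>n2 \<in> \<sigma> \<inter> int_lattice. x = n1 + n2 \<longrightarrow> n1 = 0 \<or> n2 = 0}"

definition minimal_subdivision :: "(real^3) set set \<Rightarrow> (real^3) set set \<Rightarrow> bool" where
  "minimal_subdivision \<Sigma> \<Gamma> \<longleftrightarrow>
     (\<forall>\<rho>\<in>rays \<Sigma>. \<rho> \<in> rays \<Gamma> \<or>
        (\<exists>\<sigma>\<in>\<Gamma>. dim \<sigma> = 3 \<and> (\<exists>g\<in>irreducible_points \<sigma>. \<rho> = convex_cone hull {g})))"

section \<open>The singularity and the weight vectors\<close>

definition f_E8 :: poly3 where
  "f_E8 = pvar 3 ^ 2 + pvar 2 ^ 3 + pvar 1 ^ 5"

definition W_E8 :: "(real^3) set" where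
  "W_E8 =
    {vector [1,1,1], vector [1,1,2], vector [1,2,2], vector [1,2,3], vector [2,2,3],
     vector [2,3,4], vector [2,3,5], vector [2,4,5], vector [3,4,6], vector [3,5,7],
     vector [3,5,8], vector [4,6,8], vector [4,6,9], vector [4,7,10], vector [5,7,11],
     vector [5,8,11], vector [5,8,12], vector [5,9,13], vector [5,9,14], vector [6,10,14],
     vector [6,10,15]}"

end

(*
  The rays of the subdivision can be inserted one at a time: starting from the cone over e1, e2, e3,
  nineteen star subdivisions, each at the sum of the generators of a cone, produce the nineteen
  primitive vectors of W (the vectors (4,6,8) and (6,10,14) are twice (2,3,4) and (3,5,7)).  A star
  subdivision keeps each cone unimodular.  It also keeps the property that every point of the
  orthant is in exactly one way a nonnegative combination of the generators of some cone, from which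
  the fan axioms follow.  The dual fan of f is the star subdivision of the orthant at (6,10,15), and
  each of the 39 maximal cones obtained lies in one of its three maximal cones.

  Minimality fails at (5,9,14): this vector is interior to the maximal cone on which x^5 is minimal,
  and (5,9,14) = (0,0,1) + (5,9,13) decomposes it, and its integer multiples, inside that cone.
*)
theory Submission
  imports Defs
begin

section \<open>Triangulated cones\<close>

text \<open>Weights are functions on the whole space, so representations over different generating
  sets can be compared by equality. The sum runs over the support; an infinite support gives the
  default 0.\<close>

definition cone_comb :: "('a::real_vector \<Rightarrow> real) \<Rightarrow> 'a" where
  "cone_comb a = (\<Sum>v | a v \<noteq> 0. a v *\<^sub>R v)"

text \<open>The abstract complex: each point is a nonnegative weight function supported in one
  generating set, and weights supported on a common face are identified automatically.\<close>

definition cone_weights :: "'a set set \<Rightarrow> ('a \<Rightarrow> real) set" where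
  "cone_weights F = {a. (\<forall>v. 0 \<le> a v) \<and> (\<exists>S\<in>F. \<forall>v. a v \<noteq> 0 \<longrightarrow> v \<in> S)}"

text \<open>A cone complex is given by the generating sets of its maximal cones.\<close>

definition triangulates :: "'a::real_vector set set \<Rightarrow> 'a set \<Rightarrow> bool" where
  "triangulates F X \<longleftrightarrow> finite F \<and> (\<forall>S\<in>F. finite S) \<and> bij_betw cone_comb (cone_weights F) X"

lemma cone_comb_eq:
  assumes "finite S" "\<And>v. a v \<noteq> 0 \<Longrightarrow> v \<in> S"
  shows "cone_comb a = (\<Sum>v\<in>S. a v *\<^sub>R v)"
  unfolding cone_comb_def by (rule sum.mono_neutral_left) (use assms in auto)

lemma convex_cone_hull_finite:
  fixes S :: "'a::real_vector set"
  assumes fin: "finite S"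
  shows "convex_cone hull S = cone_comb ` cone_weights {S}"
proof -
  have eq: "cone_comb ` cone_weights {S} = {\<Sum>v\<in>S. c v *\<^sub>R v | c. \<forall>v\<in>S. 0 \<le> c v}" (is "?L = ?R")
  proof (intro equalityI subsetI)
    fix x assume "x \<in> ?L"
    then show "x \<in> ?R" using cone_comb_eq[OF fin] by (fastforce simp: cone_weights_def)
  next
    fix x assume "x \<in> ?R"
    then obtain c where c: "x = (\<Sum>v\<in>S. c v *\<^sub>R v)" "\<forall>v\<in>S. 0 \<le> c v" by blast
    define a where "a = (\<lambda>v. if v \<in> S then c v else 0)"
    have "x = cone_comb a"
      unfolding c(1) by (subst cone_comb_eq[OF fin]) (auto simp: a_def split: if_splits)
    moreover have "a \<in> cone_weights {S}" using c(2) by (auto simp: cone_weights_def a_def)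
    ultimately show "x \<in> ?L" by blast
  qed
  show ?thesis unfolding eq
  proof (rule hull_unique)
    show "S \<subseteq> ?R"
    proof
      fix x assume "x \<in> S"
      then have "x = (\<Sum>v\<in>S. (if v = x then 1 else 0) *\<^sub>R v)"
        using fin by (simp add: if_distrib[of "\<lambda>c. c *\<^sub>R _"] sum.delta cong: if_cong)
      then show "x \<in> ?R" by (intro CollectI exI[of _ "\<lambda>v. if v = x then 1 else 0"]) auto
    qed
    show "convex_cone ?R"
      unfolding convex_cone_iff
    proof (intro conjI ballI allI impI)
      show "0 \<in> ?R" by (intro CollectI exI[of _ "\<lambda>_. 0"]) auto
    next
      fix x y assume "x \<in> ?R" "y \<in> ?R"
      then obtain c d where "x = (\<Sum>v\<in>S. c v *\<^sub>R v)" "\<forall>v\<in>S. 0 \<le> c v"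
        "y = (\<Sum>v\<in>S. d v *\<^sub>R v)" "\<forall>v\<in>S. 0 \<le> d v" by blast
      then show "x + y \<in> ?R"
        by (intro CollectI exI[of _ "\<lambda>v. c v + d v"]) (auto simp: scaleR_add_left sum.distrib)
    next
      fix x and k :: real assume "x \<in> ?R" "0 \<le> k"
      then obtain c where "x = (\<Sum>v\<in>S. c v *\<^sub>R v)" "\<forall>v\<in>S. 0 \<le> c v" by blast
      then show "k *\<^sub>R x \<in> ?R"
        using \<open>0 \<le> k\<close> by (intro CollectI exI[of _ "\<lambda>v. k * c v"]) (auto simp: scaleR_sum_right)
    qed
  next
    fix T assume T: "S \<subseteq> T" "convex_cone T"
    have sum: "(\<Sum>v\<in>A. c v *\<^sub>R v) \<in> T" if "finite A" "A \<subseteq> S" "\<forall>v\<in>S. 0 \<le> c v" for A c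
      using that
    proof (induction A rule: finite_induct)
      case empty
      then show ?case using T(2) by (simp add: convex_cone_contains_0)
    next
      case (insert x A)
      then show ?case using T by (auto intro!: convex_cone_add convex_cone_scaleR)
    qed
    then show "?R \<subseteq> T" using fin by blast
  qed
qed

lemma cone_comb_linear:
  assumes "a \<in> cone_weights {S}" "b \<in> cone_weights {S}" "finite S" "0 \<le> s" "0 \<le> t"
  shows "(\<lambda>v. s * a v + t * b v) \<in> cone_weights {S}"
    and "cone_comb (\<lambda>v. s * a v + t * b v) = s *\<^sub>R cone_comb a + t *\<^sub>R cone_comb b"
proof -
  show *: "(\<lambda>v. s * a v + t * b v) \<in> cone_weights {S}"
    using assms by (simp add: cone_weights_def) (metis add_0 mult_zero_right)
  have "cone_comb x = (\<Sum>v\<in>S. x v *\<^sub>R v)" if "x \<in> cone_weights {S}" for x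
    using that assms(3) by (intro cone_comb_eq) (auto simp: cone_weights_def)
  then show "cone_comb (\<lambda>v. s * a v + t * b v) = s *\<^sub>R cone_comb a + t *\<^sub>R cone_comb b"
    using * assms by (simp add: scaleR_add_left sum.distrib scaleR_sum_right)
qed

text \<open>If a generator \<open>s\<close> has positive weight in \<open>x \<in> \<tau>\<close> and
  \<open>r\<close> is the rest of the combination, then \<open>x\<close> is the midpoint of twice
  the \<open>s\<close>-part and twice \<open>r\<close>. Both lie in the cone, so the face contains
  the former and, being conic, contains \<open>s\<close>.\<close>

lemma face_of_convex_cone_hull:
  fixes S :: "'a::euclidean_space set"
  assumes fin: "finite S" and face: "\<tau> face_of convex_cone hull S" and "\<tau> \<noteq> {}"
  shows "\<tau> = convex_cone hull (S \<inter> \<tau>)"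
proof
  have "conic \<tau>" using face conic_convex_cone_hull by (rule face_of_conic[rotated])
  then have cc: "convex_cone \<tau>"
    using face assms(3) by (simp add: convex_cone_def face_of_imp_convex)
  then show "convex_cone hull (S \<inter> \<tau>) \<subseteq> \<tau>" by (simp add: hull_minimal)
  show "\<tau> \<subseteq> convex_cone hull (S \<inter> \<tau>)"
  proof
    fix x assume x: "x \<in> \<tau>"
    then have "x \<in> convex_cone hull S" using face face_of_imp_subset by blast
    then obtain a where a: "a \<in> cone_weights {S}" "x = cone_comb a"
      using convex_cone_hull_finite[OF fin] by blast
    have nn: "0 \<le> a v" and supp: "a v \<noteq> 0 \<Longrightarrow> v \<in> S" for v
      using a by (auto simp: cone_weights_def)
    have "s \<in> \<tau>" if s: "a s \<noteq> 0" for s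
    proof -
      have sS: "s \<in> S" using s supp by blast
      have as: "a s > 0" using s nn[of s] by simp
      define r where "r = (\<Sum>v\<in>S - {s}. a v *\<^sub>R v)"
      have x_eq: "x = a s *\<^sub>R s + r"
        unfolding a(2) r_def using fin sS supp by (subst cone_comb_eq[of S]) (auto simp: sum.remove)
      have in1: "(2 * a s) *\<^sub>R s \<in> convex_cone hull S"
        using as sS by (simp add: convex_cone_hull_mul hull_inc)
      have "r = cone_comb (a(s := 0))"
        unfolding r_def using fin supp by (subst cone_comb_eq[of "S - {s}"]) (auto split: if_splits)
      moreover have "a(s := 0) \<in> cone_weights {S}" using nn supp by (auto simp: cone_weights_def)
      ultimately have "r \<in> convex_cone hull S" by (simp add: convex_cone_hull_finite[OF fin])
      then have in2: "2 *\<^sub>R r \<in> convex_cone hull S" by (simp add: convex_cone_hull_mul)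
      have "(2 * a s) *\<^sub>R s \<in> \<tau>"
      \<comment> \<open>An open segment needs distinct end points; if they coincide, both equal
        \<open>x\<close>.\<close>
      proof (cases "(2 * a s) *\<^sub>R s = 2 *\<^sub>R r")
        case True
        then have "a s *\<^sub>R s = r" by (metis scaleR_scaleR scaleR_cancel_left zero_neq_numeral)
        then have "x = (2 * a s) *\<^sub>R s" using x_eq by (simp add: scaleR_2 flip: scaleR_scaleR)
        then show ?thesis using x by simp
      next
        case False
        have "x = (1 - 1/2) *\<^sub>R (2 * a s) *\<^sub>R s + (1/2) *\<^sub>R 2 *\<^sub>R r" by (simp add: x_eq)
        then have "x \<in> open_segment ((2 * a s) *\<^sub>R s) (2 *\<^sub>R r)"
          using False unfolding in_segment by (intro conjI exI[of _ "1/2"]) auto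
        then show ?thesis using face in1 in2 x by (meson face_ofD)
      qed
      then have "(1 / (2 * a s)) *\<^sub>R ((2 * a s) *\<^sub>R s) \<in> \<tau>"
        using cc as by (intro convex_cone_scaleR[where c = "1 / (2 * a s)"]) auto
      then show ?thesis using as by simp
    qed
    then have "a \<in> cone_weights {S \<inter> \<tau>}" using nn supp by (auto simp: cone_weights_def)
    then show "x \<in> convex_cone hull (S \<inter> \<tau>)"
      using a(2) fin by (subst convex_cone_hull_finite) auto
  qed
qed

lemma convex_cone_hull_singleton: "convex_cone hull {v} = {t *\<^sub>R v | t. 0 \<le> t}"
proof (intro equalityI subsetI)
  fix x assume "x \<in> convex_cone hull {v}"
  then obtain a where "x = cone_comb a" "a \<in> cone_weights {{v}}"
    using convex_cone_hull_finite[of "{v}"] by auto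
  then have "x = a v *\<^sub>R v" "0 \<le> a v"
    using cone_comb_eq[of "{v}" a] by (auto simp: cone_weights_def)
  then show "x \<in> {t *\<^sub>R v | t. 0 \<le> t}" by blast
qed (auto intro: convex_cone_hull_mul hull_inc)

lemma convex_cone_hull_scaled:
  assumes "0 < c"
  shows "convex_cone hull {c *\<^sub>R v} = convex_cone hull {v}"
proof -
  have "t *\<^sub>R v = (t / c) *\<^sub>R c *\<^sub>R v" for t using assms by simp
  then have "{t *\<^sub>R v | t. 0 \<le> t} \<subseteq> {t *\<^sub>R c *\<^sub>R v | t. 0 \<le> t}"
    using assms by (smt (verit) Collect_mono_iff divide_nonneg_pos)
  moreover have "t *\<^sub>R c *\<^sub>R v \<in> {t *\<^sub>R v | t. 0 \<le> t}" if "0 \<le> t" for t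
    using that assms by (intro CollectI exI[of _ "t * c"]) auto
  then have "{t *\<^sub>R c *\<^sub>R v | t. 0 \<le> t} \<subseteq> {t *\<^sub>R v | t. 0 \<le> t}" by blast
  ultimately show ?thesis by (simp add: convex_cone_hull_singleton)
qed

text \<open>Subsets of the maximal generating sets are included so that faces belong to the family;
  the empty subset gives the origin.\<close>

definition simplicial_cones :: "'a::real_vector set set \<Rightarrow> 'a set set" where
  "simplicial_cones F = {convex_cone hull S | S T. S \<subseteq> T \<and> T \<in> F}"

section \<open>Intersections, faces and union of the cones of a triangulation\<close>

lemma triangulates_inj:
  assumes "triangulates F X" "S \<in> F" "T \<in> F" "a \<in> cone_weights {S}" "b \<in> cone_weights {T}"
    and "cone_comb a = cone_comb b"
  shows "a = b"
proof -
  have "a \<in> cone_weights F" "b \<in> cone_weights F"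
    using assms by (auto simp: cone_weights_def)
  then show ?thesis using assms by (metis triangulates_def bij_betw_def inj_onD)
qed

lemma cone_weights_mono: "S \<subseteq> T \<Longrightarrow> cone_weights {S} \<subseteq> cone_weights {T}"
  by (auto simp: cone_weights_def)

text \<open>A common point has only one weight function, whose support therefore lies in both
  \<open>S'\<close> and \<open>T'\<close>.\<close>

lemma triangulates_Int:
  assumes tri: "triangulates F X" and ST: "S \<in> F" "T \<in> F" and sub: "S' \<subseteq> S" "T' \<subseteq> T"
  shows "convex_cone hull S' \<inter> convex_cone hull T' = convex_cone hull (S' \<inter> T')"
proof
  have fin: "finite S'" "finite T'" using tri ST sub by (auto simp: triangulates_def intro: finite_subset)
  show "convex_cone hull S' \<inter> convex_cone hull T' \<subseteq> convex_cone hull (S' \<inter> T')"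
  proof
    fix x assume "x \<in> convex_cone hull S' \<inter> convex_cone hull T'"
    then obtain a b where ab: "a \<in> cone_weights {S'}" "b \<in> cone_weights {T'}"
      "x = cone_comb a" "x = cone_comb b"
      using fin by (auto simp: convex_cone_hull_finite)
    then have "a = b"
      using triangulates_inj[OF tri ST] cone_weights_mono[OF sub(1)] cone_weights_mono[OF sub(2)]
      by (metis subsetD)
    then have "a \<in> cone_weights {S' \<inter> T'}" using ab by (auto simp: cone_weights_def)
    then show "x \<in> convex_cone hull (S' \<inter> T')"
      using fin ab by (simp add: convex_cone_hull_finite)
  qed
qed (auto intro: hull_mono[THEN subsetD])

text \<open>If a point of the smaller cone lies between \<open>x\<close> and \<open>y\<close>, the
  mixture of their weights is its unique representation and vanishes off \<open>S'\<close>. The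
  summands are nonnegative with positive factors, so the weights of \<open>x\<close> and
  \<open>y\<close> vanish there too.\<close>

lemma triangulates_face:
  fixes S :: "'a::euclidean_space set"
  assumes tri: "triangulates F X" and T: "T \<in> F" and sub: "S' \<subseteq> S" "S \<subseteq> T"
  shows "convex_cone hull S' face_of convex_cone hull S"
  unfolding face_of_def
proof (intro conjI ballI impI)
  have fin: "finite S" "finite S'" using tri T sub by (auto simp: triangulates_def intro: finite_subset)
  show "convex_cone hull S' \<subseteq> convex_cone hull S" using sub by (simp add: hull_mono)
  show "convex (convex_cone hull S')" by (rule convex_convex_cone_hull)
  fix x y z assume x: "x \<in> convex_cone hull S" and y: "y \<in> convex_cone hull S"
    and z: "z \<in> convex_cone hull S'" "z \<in> open_segment x y"
  obtain a b c where ab: "a \<in> cone_weights {S}" "b \<in> cone_weights {S}" "x = cone_comb a" "y = cone_comb b"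
    and c: "c \<in> cone_weights {S'}" "z = cone_comb c"
    using x y z(1) fin by (auto simp: convex_cone_hull_finite)
  obtain u where u: "0 < u" "u < 1" "z = (1 - u) *\<^sub>R x + u *\<^sub>R y"
    using z(2) by (auto simp: in_segment)
  define d where "d = (\<lambda>v. (1 - u) * a v + u * b v)"
  have "d \<in> cone_weights {S}" "cone_comb d = z"
    using cone_comb_linear[OF ab(1,2) fin(1), of "1 - u" u] u ab by (auto simp: d_def)
  moreover have "d \<in> cone_weights {T}" "c \<in> cone_weights {T}"
    using calculation(1) c(1) sub by (auto simp: cone_weights_def)
  ultimately have "d = c" using triangulates_inj[OF tri T T] c(2) by simp
  then have "a v = 0 \<and> b v = 0" if "v \<notin> S'" for v
  proof -
    have "d v = 0" using \<open>d = c\<close> c that by (auto simp: cone_weights_def)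
    moreover have "0 \<le> (1 - u) * a v" "0 \<le> u * b v"
      using ab u by (auto simp: cone_weights_def)
    ultimately have "(1 - u) * a v = 0" "u * b v = 0" unfolding d_def by linarith+
    then show ?thesis using u by simp
  qed
  then have "a \<in> cone_weights {S'}" "b \<in> cone_weights {S'}"
    using ab by (auto simp: cone_weights_def)
  then show "x \<in> convex_cone hull S'" "y \<in> convex_cone hull S'"
    using ab fin by (auto simp: convex_cone_hull_finite)
qed

lemma Union_simplicial_cones:
  assumes "triangulates F X"
  shows "\<Union>(simplicial_cones F) = X"
proof -
  have X: "X = cone_comb ` cone_weights F"
    using assms by (simp add: triangulates_def bij_betw_def)
  have fin: "finite S" if "S \<subseteq> T" "T \<in> F" for S T
    using assms that by (auto simp: triangulates_def intro: finite_subset)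
  have "cone_weights F = (\<Union>T\<in>F. cone_weights {T})" by (auto simp: cone_weights_def)
  then have "X = (\<Union>T\<in>F. cone_comb ` cone_weights {T})" by (simp only: X image_UN)
  also have "\<dots> = (\<Union>T\<in>F. convex_cone hull T)"
    using fin by (intro SUP_cong refl convex_cone_hull_finite[symmetric]) auto
  finally have X_eq: "X = (\<Union>T\<in>F. convex_cone hull T)" .
  show ?thesis
  proof
    show "\<Union>(simplicial_cones F) \<subseteq> X"
    proof
      fix x assume "x \<in> \<Union>(simplicial_cones F)"
      then obtain S T where "x \<in> convex_cone hull S" "S \<subseteq> T" "T \<in> F"
        by (auto simp: simplicial_cones_def)
      then show "x \<in> X" unfolding X_eq using hull_mono[of S T convex_cone] by blast
    qed
    show "X \<subseteq> \<Union>(simplicial_cones F)" unfolding X_eq simplicial_cones_def by blast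
  qed
qed

lemma finite_simplicial_cones:
  assumes "triangulates F X" shows "finite (simplicial_cones F)"
proof -
  have "simplicial_cones F = (\<lambda>S. convex_cone hull S) ` (\<Union>T\<in>F. Pow T)"
    by (auto simp: simplicial_cones_def)
  then show ?thesis using assms by (auto simp: triangulates_def)
qed

section \<open>Star subdivisions\<close>

text \<open>The sets \<open>S - {t}\<close> with \<open>t \<in> \<tau>\<close> generate the facets
  of a simplicial cone that do not contain the face over \<open>\<tau>\<close>; the new generator is
  joined to each. Taking the plain sum as this generator preserves unimodularity.\<close>

definition star :: "'a::comm_monoid_add set \<Rightarrow> 'a set set \<Rightarrow> 'a set set" where
  "star \<tau> F = {S \<in> F. \<not> \<tau> \<subseteq> S} \<union> {insert (\<Sum>\<tau>) (S - {t}) | S t. S \<in> F \<and> \<tau> \<subseteq> S \<and> t \<in> \<tau>}"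

text \<open>This form mirrors the \<open>concat\<close> and \<open>map\<close> of the list version
  \<open>star_list\<close>.\<close>

lemma star_eq_UN:
  "star \<tau> F = (\<Union>S\<in>F. if \<tau> \<subseteq> S then (\<lambda>t. insert (\<Sum>\<tau>) (S - {t})) ` \<tau> else {S})"
proof (intro set_eqI)
  fix x
  have "x \<in> star \<tau> F \<longleftrightarrow> (\<exists>S\<in>F. (\<not> \<tau> \<subseteq> S \<and> x = S) \<or> (\<tau> \<subseteq> S \<and> (\<exists>t\<in>\<tau>. x = insert (\<Sum>\<tau>) (S - {t}))))"
    unfolding star_def by blast
  also have "\<dots> \<longleftrightarrow> x \<in> (\<Union>S\<in>F. if \<tau> \<subseteq> S then (\<lambda>t. insert (\<Sum>\<tau>) (S - {t})) ` \<tau> else {S})"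
    unfolding UN_iff by (intro bex_cong refl) (simp add: image_iff)
  finally show "x \<in> star \<tau> F \<longleftrightarrow> x \<in> (\<Union>S\<in>F. if \<tau> \<subseteq> S then (\<lambda>t. insert (\<Sum>\<tau>) (S - {t})) ` \<tau> else {S})" .
qed

text \<open>Otherwise the sum would have two representations.\<close>

lemma sum_notin_vertices:
  assumes tri: "triangulates F X" and "S0 \<in> F" "\<tau> \<subseteq> S0" "2 \<le> card \<tau>" "S \<in> F"
  shows "\<Sum>\<tau> \<notin> S"
proof
  assume "\<Sum>\<tau> \<in> S"
  define a where "a = (\<lambda>u. if u = \<Sum>\<tau> then 1 else 0 :: real)"
  define b where "b = (\<lambda>u. if u \<in> \<tau> then 1 else 0 :: real)"
  have fin: "finite \<tau>" using assms(4) by (metis card.infinite not_numeral_le_zero)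
  have "a \<in> cone_weights F" "b \<in> cone_weights F"
    using assms \<open>\<Sum>\<tau> \<in> S\<close> by (auto simp: cone_weights_def a_def b_def)
  moreover have "cone_comb a = \<Sum>\<tau>"
    by (subst cone_comb_eq[of "{\<Sum>\<tau>}"]) (auto simp: a_def split: if_splits)
  moreover have "cone_comb b = \<Sum>\<tau>"
    using fin by (subst cone_comb_eq[of \<tau>]) (auto simp: b_def split: if_splits)
  ultimately have "a = b"
    using tri by (metis triangulates_def bij_betw_def inj_onD)
  then have "\<tau> \<subseteq> {\<Sum>\<tau>}" by (auto simp: a_def b_def fun_eq_iff split: if_splits)
  then have "card \<tau> \<le> card {\<Sum>\<tau>}" by (rule card_mono[rotated]) simp
  then show False using assms(4) by simp
qed

text \<open>The bijection is transported: weights over the star correspond one to one, through a map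
  preserving \<open>cone_comb\<close>, to weights over \<open>F\<close>.\<close>

lemma triangulates_star:
  assumes tri: "triangulates F X" and card: "2 \<le> card \<tau>"
  shows "triangulates (star \<tau> F) X"
proof (cases "\<exists>S\<in>F. \<tau> \<subseteq> S")
  case False
  then have "star \<tau> F = F" by (auto simp: star_def)
  then show ?thesis using tri by simp
next
  case True
  then obtain S0 where S0: "S0 \<in> F" "\<tau> \<subseteq> S0" by blast
  define v where "v = \<Sum>\<tau>"
  have v: "v \<notin> S" if "S \<in> F" for S
    using sum_notin_vertices[OF tri S0 card that] by (simp add: v_def)
  have v\<tau>: "v \<notin> \<tau>" using v[OF S0(1)] S0(2) by blast
  have fin\<tau>: "finite \<tau>" and "\<tau> \<noteq> {}" using card by (auto intro: card_ge_0_finite)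
  have finS: "finite S" if "S \<in> F" for S
    using tri that by (simp add: triangulates_def)
  have finF: "finite F" using tri by (simp add: triangulates_def)
  have fin_star: "finite (star \<tau> F)"
  proof -
    have "star \<tau> F \<subseteq> F \<union> (\<lambda>(S, t). insert v (S - {t})) ` (F \<times> \<tau>)"
      by (auto simp: star_def v_def)
    then show ?thesis by (rule finite_subset) (use finF fin\<tau> in auto)
  qed
  have fin_star': "finite S" if "S \<in> star \<tau> F" for S
    using that finS by (auto simp: star_def)
  \<comment> \<open>\<open>\<phi>\<close> redistributes the weight of the new vertex \<open>v\<close> over \<open>\<tau>\<close>; its inverse \<open>\<psi>\<close> moves the
    smallest weight on \<open>\<tau>\<close> to \<open>v\<close>.\<close>
  define \<phi> where "\<phi> = (\<lambda>a u. if u = v then 0 else a u + (if u \<in> \<tau> then a v else (0::real)))"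
  define m where "m = (\<lambda>b. Min (b ` \<tau>) :: real)"
  define \<psi> where "\<psi> = (\<lambda>b u. if u = v then m b else b u - (if u \<in> \<tau> then m b else (0::real)))"
  have m_le: "m b \<le> b t" if "t \<in> \<tau>" for b t
    using that fin\<tau> by (simp add: m_def)
  have m_ex: "\<exists>t\<in>\<tau>. m b = b t" for b
  proof -
    have "m b \<in> b ` \<tau>" unfolding m_def using fin\<tau> \<open>\<tau> \<noteq> {}\<close> by (intro Min_in) auto
    then show ?thesis by blast
  qed
  \<comment> \<open>No cone of the star contains all of \<open>\<tau>\<close>: an old one by
    selection, a new one because it lacks \<open>t\<close> and \<open>v \<notin> \<tau>\<close>. The
    resulting zero on \<open>\<tau>\<close> makes the weight of \<open>v\<close> recoverable as a
    minimum.\<close>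
  have zero_ex: "\<exists>t\<in>\<tau>. a t = 0" if a: "a \<in> cone_weights (star \<tau> F)" for a
  proof -
    obtain S where S: "S \<in> star \<tau> F" "\<And>u. a u \<noteq> 0 \<Longrightarrow> u \<in> S"
      using a by (auto simp: cone_weights_def)
    have "\<not> \<tau> \<subseteq> S"
      using S(1) v\<tau> by (auto simp: star_def v_def)
    then show ?thesis using S(2) by blast
  qed
  have \<phi>_in: "\<phi> a \<in> cone_weights F" if a: "a \<in> cone_weights (star \<tau> F)" for a
  proof -
    obtain S where S: "S \<in> star \<tau> F" "\<And>u. a u \<noteq> 0 \<Longrightarrow> u \<in> S" and nn: "\<And>u. 0 \<le> a u"
      using a by (auto simp: cone_weights_def)
    have "\<exists>S\<in>F. \<forall>u. \<phi> a u \<noteq> 0 \<longrightarrow> u \<in> S"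
    proof (cases "S \<in> F \<and> \<not> \<tau> \<subseteq> S")
      case True
      then have "a v = 0" using v S(2) by blast
      then show ?thesis using True S(2) by (intro bexI[of _ S]) (auto simp: \<phi>_def)
    next
      case False
      then obtain S' t where S': "S = insert v (S' - {t})" "S' \<in> F" "\<tau> \<subseteq> S'" "t \<in> \<tau>"
        using S(1) by (auto simp: star_def v_def)
      have "u \<in> S'" if "\<phi> a u \<noteq> 0" for u
        using that S(2)[of u] S' by (auto simp: \<phi>_def split: if_splits)
      then show ?thesis using S'(2) by blast
    qed
    moreover have "0 \<le> \<phi> a u" for u using nn by (simp add: \<phi>_def)
    ultimately show ?thesis by (simp add: cone_weights_def)
  qed
  have comb_\<phi>: "cone_comb (\<phi> a) = cone_comb a" if a: "a \<in> cone_weights (star \<tau> F)" for a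
  proof -
    obtain S where S: "S \<in> star \<tau> F" "\<And>u. a u \<noteq> 0 \<Longrightarrow> u \<in> S" 
      using a by (auto simp: cone_weights_def)
    define U where "U = S \<union> \<tau> - {v}"
    have fU: "finite U" and vU: "v \<notin> U" and \<tau>U: "\<tau> \<subseteq> U"
      using fin_star'[OF S(1)] fin\<tau> v\<tau> by (auto simp: U_def)
    have "cone_comb (\<phi> a) = (\<Sum>u\<in>U. \<phi> a u *\<^sub>R u)"
      using fU S(2) by (intro cone_comb_eq) (auto simp: \<phi>_def U_def split: if_splits)
    also have "\<dots> = (\<Sum>u\<in>U. a u *\<^sub>R u + (if u \<in> \<tau> then a v *\<^sub>R u else 0))"
      using vU by (intro sum.cong) (auto simp: \<phi>_def algebra_simps)
    also have "\<dots> = (\<Sum>u\<in>U. a u *\<^sub>R u) + (\<Sum>u\<in>\<tau>. a v *\<^sub>R u)"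
      using fU \<tau>U by (simp add: sum.distrib sum.If_cases Int_absorb1 Int_absorb2)
    also have "(\<Sum>u\<in>\<tau>. a v *\<^sub>R u) = a v *\<^sub>R v"
      by (simp add: v_def scaleR_sum_right)
    also have "(\<Sum>u\<in>U. a u *\<^sub>R u) + a v *\<^sub>R v = (\<Sum>u\<in>insert v U. a u *\<^sub>R u)"
      using fU vU by (simp add: add.commute)
    also have "\<dots> = cone_comb a"
      using fU S(2) by (intro cone_comb_eq[symmetric]) (auto simp: U_def)
    finally show ?thesis .
  qed
  have \<psi>_in: "\<psi> b \<in> cone_weights (star \<tau> F)" and \<phi>\<psi>: "\<phi> (\<psi> b) = b" if b: "b \<in> cone_weights F" for b
  proof -
    obtain S where S: "S \<in> F" "\<And>u. b u \<noteq> 0 \<Longrightarrow> u \<in> S" and nn: "\<And>u. 0 \<le> b u"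
      using b by (auto simp: cone_weights_def)
    have bv: "b v = 0" using S v by blast
    show "\<phi> (\<psi> b) = b" using bv by (auto simp: \<phi>_def \<psi>_def fun_eq_iff)
    obtain t where t: "t \<in> \<tau>" "m b = b t" using m_ex by blast
    have "\<exists>S\<in>star \<tau> F. \<forall>u. \<psi> b u \<noteq> 0 \<longrightarrow> u \<in> S"
    proof (cases "\<tau> \<subseteq> S")
      case True
      \<comment> \<open>Subtracting the minimum makes the weight at \<open>t\<close> zero, so
        \<open>t\<close> may be replaced by \<open>v\<close>.\<close>
      then have "insert v (S - {t}) \<in> star \<tau> F" using S t by (auto simp: star_def v_def)
      moreover have "u \<in> insert v (S - {t})" if "\<psi> b u \<noteq> 0" for u
        using that S(2)[of u] True t by (auto simp: \<psi>_def split: if_splits)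
      ultimately show ?thesis by blast
    next
      case False
      \<comment> \<open>An element of \<open>\<tau>\<close> outside \<open>S\<close> has weight 0,
        so the minimum is 0 and nothing is moved to \<open>v\<close>.\<close>
      then obtain s where "s \<in> \<tau>" "b s = 0" using S(2) by blast
      then have "m b = 0" using m_le[of s b] t(2) nn[of t] by simp
      then have "\<psi> b = b" using bv by (auto simp: \<psi>_def fun_eq_iff)
      then show ?thesis using False S by (intro bexI[of _ S]) (auto simp: star_def)
    qed
    moreover have "0 \<le> \<psi> b u" for u using nn m_le[of u b] t(2) by (simp add: \<psi>_def)
    ultimately show "\<psi> b \<in> cone_weights (star \<tau> F)" by (simp add: cone_weights_def)
  qed
  have \<psi>\<phi>: "\<psi> (\<phi> a) = a" if a: "a \<in> cone_weights (star \<tau> F)" for a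
  proof -
    obtain t where t: "t \<in> \<tau>" "a t = 0" using zero_ex[OF a] by blast
    have nn: "\<And>u. 0 \<le> a u" using a by (auto simp: cone_weights_def)
    obtain s where s: "s \<in> \<tau>" "m (\<phi> a) = \<phi> a s" using m_ex by blast
    have "t \<noteq> v" using t(1) v\<tau> by blast
    \<comment> \<open>At \<open>t\<close> the redistributed weight is exactly \<open>a v\<close>;
      elsewhere on \<open>\<tau>\<close> it is at least \<open>a v\<close>.\<close>
    then have "m (\<phi> a) \<le> a v" using m_le[OF t(1), of "\<phi> a"] t by (simp add: \<phi>_def)
    moreover have "a v \<le> m (\<phi> a)" using s nn[of s] v\<tau> by (auto simp: \<phi>_def)
    ultimately have "m (\<phi> a) = a v" by simp
    then show ?thesis by (auto simp: \<psi>_def fun_eq_iff) (auto simp: \<phi>_def)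
  qed
  have "bij_betw \<phi> (cone_weights (star \<tau> F)) (cone_weights F)"
    using \<phi>_in \<psi>_in \<phi>\<psi> \<psi>\<phi> by (intro bij_betw_byWitness[where f' = \<psi>]) auto
  then have "bij_betw (cone_comb \<circ> \<phi>) (cone_weights (star \<tau> F)) X"
    using tri by (auto simp: triangulates_def intro: bij_betw_trans)
  then have "bij_betw cone_comb (cone_weights (star \<tau> F)) X"
    by (rule bij_betw_cong[THEN iffD1, rotated]) (simp add: comb_\<phi>)
  then show ?thesis using fin_star fin_star' by (simp add: triangulates_def)
qed

section \<open>Unimodular triangulations and regular fans\<close>

definition unimodular :: "(real^3) set set \<Rightarrow> bool" where
  "unimodular F \<longleftrightarrow> (\<forall>S\<in>F. card S = 3 \<and> int_module.span S = int_lattice)"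

lemma int_span_subset_span: "int_module.span S \<subseteq> span (S :: (real^3) set)"
proof (rule int_module.span_minimal)
  show "S \<subseteq> span S" by (rule span_superset)
  show "int_module.subspace (span S)"
    by (auto simp: int_module.subspace_def span_zero span_add span_scale)
qed

lemma axis_in_int_lattice: "axis i 1 \<in> int_lattice"
  by (simp add: int_lattice_def axis_def)

text \<open>The standard basis lies in the integer span, so \<open>S\<close> spans the real space;
  three spanning vectors are independent over the reals, hence over the integers.\<close>

lemma lattice_generators:
  fixes S :: "(real^3) set"
  assumes card: "card S = 3" and span: "int_module.span S = int_lattice"
  shows "independent S" "lattice_basis S"
proof -
  have fin: "finite S" using card by (auto intro: card_ge_0_finite)
  have "Basis \<subseteq> int_module.span S"
    using axis_in_int_lattice span by (auto simp: Basis_vec_def)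
  then have "Basis \<subseteq> span S" using int_span_subset_span by blast
  then have "UNIV \<subseteq> span S" by (metis span_Basis span_mono span_span)
  then show ind: "independent S"
    using card fin by (intro card_le_dim_spanning[of S UNIV]) auto
  have "int_module.independent S"
    unfolding int_module.independent_explicit_module
  proof (intro allI impI)
    fix t u v assume "finite t" "t \<subseteq> S" "(\<Sum>v\<in>t. of_int (u v) *\<^sub>R v) = 0" "v \<in> t"
    then have "real_of_int (u v) = 0"
      using ind[unfolded real_vector.independent_explicit_module, rule_format, of t "\<lambda>v. of_int (u v)" v]
      by simp
    then show "u v = 0" by simp
  qed
  then show "lattice_basis S" using span by (simp add: lattice_basis_def)
qed

text \<open>Replacing \<open>t\<close> by \<open>\<Sum>\<tau>\<close> is reversible over the
  integers, since \<open>t\<close> is that sum minus the other elements of \<open>\<tau>\<close>.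
  The sum lies outside \<open>S\<close>, so the cardinality stays 3.\<close>

lemma unimodular_star:
  assumes tri: "triangulates F X" and card: "2 \<le> card \<tau>" and uni: "unimodular F"
  shows "unimodular (star \<tau> F)"
  unfolding unimodular_def
proof
  fix S' assume "S' \<in> star \<tau> F"
  then consider "S' \<in> F" | S t where "S' = insert (\<Sum>\<tau>) (S - {t})" "S \<in> F" "\<tau> \<subseteq> S" "t \<in> \<tau>"
    by (auto simp: star_def)
  then show "card S' = 3 \<and> int_module.span S' = int_lattice"
  proof cases
    case 1
    then show ?thesis using uni by (auto simp: unimodular_def)
  next
    case 2
    have fin: "finite S" using tri 2 by (auto simp: triangulates_def)
    have S: "card S = 3" "int_module.span S = int_lattice"
      using uni 2 by (auto simp: unimodular_def)
    have "\<Sum>\<tau> \<notin> S" using sum_notin_vertices[OF tri 2(2,3) card 2(2)] .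
    then have "card S' = 3" using S fin 2 by (auto simp: card_insert_if card_Diff_singleton)
    moreover have "int_module.span S' = int_module.span S"
    proof
      have "\<Sum>\<tau> \<in> int_module.span S" using 2 by (intro int_module.span_sum int_module.span_base) auto
      then show "int_module.span S' \<subseteq> int_module.span S"
        using 2 by (intro int_module.span_minimal) (auto intro: int_module.span_base)
      have "finite \<tau>" using 2 fin finite_subset by blast
      then have t: "t = \<Sum>\<tau> - \<Sum>(\<tau> - {t})" using 2 by (simp add: sum_diff1)
      have "\<Sum>\<tau> - \<Sum>(\<tau> - {t}) \<in> int_module.span S'"
        using 2 by (intro int_module.span_diff int_module.span_sum int_module.span_base) auto
      then have "t \<in> int_module.span S'" using t by simp
      then have "S \<subseteq> int_module.span S'" using 2 by (auto intro: int_module.span_base)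
      then show "int_module.span S \<subseteq> int_module.span S'"
        by (intro int_module.span_minimal) auto
    qed
    ultimately show ?thesis using S by simp
  qed
qed

text \<open>Unique representation makes intersections and faces correspond to subsets of generators.
  Strong convexity holds because the orthant contains no line, regularity because the generators of
  a maximal cone form a lattice basis.\<close>

lemma regular_fan_simplicial_cones:
  assumes tri: "triangulates F orthant" and uni: "unimodular F" and "F \<noteq> {}"
  shows "regular_fan (simplicial_cones F)"
  unfolding regular_fan_def is_fan_def
proof (intro conjI ballI allI impI)
  show "finite (simplicial_cones F)" using finite_simplicial_cones[OF tri] .
  show "simplicial_cones F \<noteq> {}" using \<open>F \<noteq> {}\<close> by (auto simp: simplicial_cones_def)
next
  fix \<sigma> assume \<sigma>: "\<sigma> \<in> simplicial_cones F"
  then obtain S T where S: "\<sigma> = convex_cone hull S" "S \<subseteq> T" "T \<in> F"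
    by (auto simp: simplicial_cones_def)
  have T: "finite T" "card T = 3" "int_module.span T = int_lattice"
    using uni tri S by (auto simp: unimodular_def triangulates_def)
  have "T \<subseteq> int_lattice" using int_module.span_superset[of T] T(3) by simp
  then show "rational_cone \<sigma>"
    unfolding rational_cone_def using S T(1) finite_subset[OF S(2)]
    by (intro exI[of _ S] conjI) auto
  have "\<sigma> \<subseteq> orthant" using Union_simplicial_cones[OF tri] \<sigma> by blast
  have "0 \<in> \<sigma>" using S by (simp add: convex_cone_hull_contains_0)
  have neg: "x = 0" if "x \<in> orthant" "- x \<in> orthant" for x
    using that by (auto simp: orthant_def vec_eq_iff intro: order.antisym)
  show "strongly_convex \<sigma>"
    unfolding strongly_convex_def
  proof (intro equalityI subsetI)
    fix x assume "x \<in> \<sigma> \<inter> uminus ` \<sigma>"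
    then have "x \<in> \<sigma>" "- x \<in> \<sigma>" by auto
    then show "x \<in> {0}" using \<open>\<sigma> \<subseteq> orthant\<close> neg by blast
  qed (use \<open>0 \<in> \<sigma>\<close> in \<open>auto intro!: image_eqI[of _ _ 0]\<close>)
  show "\<exists>B S. lattice_basis B \<and> S \<subseteq> B \<and> \<sigma> = convex_cone hull S"
    using S lattice_generators(2)[OF T(2,3)] by blast
  fix \<tau> assume "\<tau> face_of \<sigma> \<and> \<tau> \<noteq> {}"
  then have "\<tau> = convex_cone hull (S \<inter> \<tau>)"
    using face_of_convex_cone_hull[of S \<tau>] S T(1) finite_subset by blast
  then show "\<tau> \<in> simplicial_cones F"
    using S unfolding simplicial_cones_def by blast
next
  fix \<sigma> \<tau> assume "\<sigma> \<in> simplicial_cones F" "\<tau> \<in> simplicial_cones F"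
  then obtain S T S' T' where S: "\<sigma> = convex_cone hull S" "S \<subseteq> T" "T \<in> F"
    and S': "\<tau> = convex_cone hull S'" "S' \<subseteq> T'" "T' \<in> F"
    by (auto simp: simplicial_cones_def)
  have eq: "\<sigma> \<inter> \<tau> = convex_cone hull (S \<inter> S')"
    using triangulates_Int[OF tri S(3) S'(3) S(2) S'(2)] S(1) S'(1) by simp
  have "convex_cone hull (S \<inter> S') face_of convex_cone hull S"
    by (rule triangulates_face[OF tri S(3)]) (use S in auto)
  then show "\<sigma> \<inter> \<tau> face_of \<sigma>" by (metis eq S(1))
  have "convex_cone hull (S \<inter> S') face_of convex_cone hull S'"
    by (rule triangulates_face[OF tri S'(3)]) (use S' in auto)
  then show "\<sigma> \<inter> \<tau> face_of \<tau>" by (metis eq S'(1))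
qed

lemma dim_convex_cone_hull: "dim (convex_cone hull S) = dim (S :: 'a::euclidean_space set)"
proof -
  have "convex_cone hull S \<subseteq> span S" by (simp add: hull_minimal span_superset convex_cone_span)
  then have "dim (convex_cone hull S) \<le> dim S" by (metis dim_span dim_subset)
  moreover have "dim S \<le> dim (convex_cone hull S)" by (simp add: dim_subset hull_subset)
  ultimately show ?thesis by simp
qed

text \<open>Generators of a unimodular cone are independent, so dimension counts them and a
  one-dimensional cone has a single generator.\<close>

lemma rays_simplicial_cones:
  assumes uni: "unimodular F"
  shows "rays (simplicial_cones F) = (\<lambda>v. convex_cone hull {v}) ` \<Union>F"
proof -
  have dim: "dim (convex_cone hull S) = card S" if "S \<subseteq> T" "T \<in> F" for S T
  proof -
    have "independent S"
      using lattice_generators(1)[of T] uni that independent_mono[of T S] by (auto simp: unimodular_def)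
    then show ?thesis by (simp add: dim_convex_cone_hull dim_eq_card_independent)
  qed
  show ?thesis
  proof (intro equalityI subsetI)
    fix \<rho> assume "\<rho> \<in> rays (simplicial_cones F)"
    then obtain S T where "\<rho> = convex_cone hull S" "S \<subseteq> T" "T \<in> F" "card S = 1"
      using dim by (auto simp: rays_def simplicial_cones_def)
    then show "\<rho> \<in> (\<lambda>v. convex_cone hull {v}) ` \<Union>F" by (auto simp: card_1_singleton_iff)
  next
    fix \<rho> assume "\<rho> \<in> (\<lambda>v. convex_cone hull {v}) ` \<Union>F"
    then obtain v T where "\<rho> = convex_cone hull {v}" "v \<in> T" "T \<in> F" by auto
    then show "\<rho> \<in> rays (simplicial_cones F)"
      using dim[of "{v}" T] by (auto simp: rays_def simplicial_cones_def)
  qed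
qed

text \<open>The starting point of the star subdivisions. The weight at \<open>axis i 1\<close> is
  the \<open>i\<close>-th coordinate of the combination, which gives injectivity and
  surjectivity.\<close>

lemma orthant_triangulation:
  defines "B \<equiv> {axis 1 1, axis 2 1, axis 3 1 :: real^3}"
  shows "triangulates {B} orthant" "unimodular {B}"
proof -
  have ne: "axis i (1::real) = axis j 1 \<longleftrightarrow> i = j" for i j :: 3 by (simp add: axis_eq_axis)
  have card: "card B = 3" by (simp add: B_def ne)
  have comb: "cone_comb a $ i = a (axis i 1)" if "a \<in> cone_weights {B}" for a i
  proof -
    have "cone_comb a = (\<Sum>v\<in>B. a v *\<^sub>R v)"
      using that by (intro cone_comb_eq) (auto simp: cone_weights_def B_def)
    then have "cone_comb a = a (axis 1 1) *\<^sub>R axis 1 1 + a (axis 2 1) *\<^sub>R axis 2 1 + a (axis 3 1) *\<^sub>R axis 3 1"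
      by (simp add: B_def ne)
    then show ?thesis using exhaust_3[of i] by (auto simp: axis_def)
  qed
  have "inj_on cone_comb (cone_weights {B})"
  proof (rule inj_onI, rule ext)
    fix a b v assume ab: "a \<in> cone_weights {B}" "b \<in> cone_weights {B}" "cone_comb a = cone_comb b"
    show "a v = b v"
    proof (cases "v \<in> B")
      case True
      then obtain i where "v = axis i 1" by (auto simp: B_def)
      then show ?thesis using comb[OF ab(1), of i] comb[OF ab(2), of i] ab(3) by simp
    next
      case False
      then have "a v = 0" "b v = 0" using ab by (auto simp: cone_weights_def)
      then show ?thesis by simp
    qed
  qed
  moreover have "cone_comb ` cone_weights {B} = orthant"
  proof (intro equalityI subsetI)
    fix x assume "x \<in> cone_comb ` cone_weights {B}"
    then show "x \<in> orthant" by (auto simp: orthant_def comb) (auto simp: cone_weights_def)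
  next
    fix x :: "real^3" assume x: "x \<in> orthant"
    define a where "a = (\<lambda>v. if v \<in> B then v \<bullet> x else 0)"
    have "a \<in> cone_weights {B}"
      using x by (auto simp: a_def cone_weights_def orthant_def B_def inner_axis')
    moreover have "cone_comb a = x"
    proof -
      have "axis i 1 \<in> B" for i using exhaust_3[of i] by (auto simp: B_def)
      then show ?thesis
        using comb[OF \<open>a \<in> cone_weights {B}\<close>] by (simp add: vec_eq_iff a_def inner_axis')
    qed
    ultimately show "x \<in> cone_comb ` cone_weights {B}" by blast
  qed
  moreover have "finite B" by (simp add: B_def)
  ultimately show "triangulates {B} orthant"
    by (simp add: triangulates_def bij_betw_def)
  have "int_module.span B = int_lattice"
  proof
    have "int_module.subspace int_lattice"
      by (auto simp: int_module.subspace_def int_lattice_def)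
    moreover have "B \<subseteq> int_lattice" using axis_in_int_lattice by (auto simp: B_def)
    ultimately show "int_module.span B \<subseteq> int_lattice" by (intro int_module.span_minimal)
    show "int_lattice \<subseteq> int_module.span B"
    proof
      fix x :: "real^3" assume "x \<in> int_lattice"
      have "\<exists>k::int. x $ i = of_int k" for i
      proof -
        have "x $ i \<in> \<int>" using \<open>x \<in> int_lattice\<close> by (simp add: int_lattice_def)
        then show ?thesis by (rule Ints_cases) blast
      qed
      then obtain k :: "3 \<Rightarrow> int" where k: "\<And>i. x $ i = of_int (k i)" by metis
      have "x = (\<Sum>i\<in>UNIV. of_int (k i) *\<^sub>R axis i 1)"
        by (simp add: vec_eq_iff sum_3 axis_def forall_3 k)
      moreover have ax: "axis i 1 \<in> int_module.span B" for i
        using exhaust_3[of i] by (intro int_module.span_base) (auto simp: B_def)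
      have "(\<Sum>i\<in>UNIV. of_int (k i) *\<^sub>R axis i 1) \<in> int_module.span B"
        by (rule int_module.span_sum, rule int_module.span_scale, rule ax)
      ultimately show "x \<in> int_module.span B" by simp
    qed
  qed
  then show "unimodular {B}" using card by (simp add: unimodular_def)
qed

section \<open>Dual fans of Brieskorn-Pham polynomials\<close>

lemma closed_orthant: "closed orthant"
  unfolding orthant_def by (intro closed_Collect_all closed_Collect_le continuous_intros)

text \<open>The Newton polyhedron depends only on the support, so the coefficients stay
  arbitrary.\<close>

locale brieskorn_pham =
  fixes f :: poly3 and e :: "3 \<Rightarrow> nat"
  assumes keys_f: "Poly_Mapping.keys f = range (\<lambda>i. axis i (e i))"
    and e_pos: "0 < e i"
begin

abbreviation P :: "(real^3) set" where "P \<equiv> newton_polyhedron f"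

definition vertex :: "3 \<Rightarrow> real^3" where "vertex i = axis i (real (e i))"

text \<open>\<open>e i * u $ i\<close> is the value of \<open>u\<close> at \<open>vertex i\<close>;
  these are the covectors giving the \<open>i\<close>-th pure power the least weight.\<close>

definition dual_cone :: "3 \<Rightarrow> (real^3) set" where
  "dual_cone i = {u \<in> orthant. \<forall>j. e i * u $ i \<le> e j * u $ j}"

text \<open>With the strict inequalities, \<open>0 < u $ i\<close> makes all coordinates positive.
  It excludes covectors whose minimal face is unbounded along the \<open>i\<close>-th axis.\<close>

definition open_dual_cone :: "3 \<Rightarrow> (real^3) set" where
  "open_dual_cone i = {u. 0 < u $ i \<and> (\<forall>j. j \<noteq> i \<longrightarrow> e i * u $ i < e j * u $ j)}"

lemma inner_vertex: "u \<bullet> vertex i = e i * u $ i"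
  by (simp add: vertex_def inner_axis mult.commute)

lemma vertex_eq_iff: "vertex i = vertex j \<longleftrightarrow> i = j"
  using e_pos[of i] e_pos[of j] by (auto simp: vertex_def axis_eq_axis)

lemma vertex_plus_in: assumes "v \<in> orthant" shows "vertex i + v \<in> P"
proof -
  have "(\<chi> k. of_nat ((axis i (e i) :: nat^3) $ k)) = vertex i"
    by (simp add: vertex_def vec_eq_iff axis_def)
  then show ?thesis
    unfolding newton_polyhedron_def keys_f using assms
    by (intro hull_inc UN_I[of "axis i (e i)"]) auto
qed

lemma vertex_in: "vertex i \<in> P"
  using vertex_plus_in[of 0 i] by (simp add: orthant_def)

text \<open>The sets whose hull is taken satisfy these half-space inequalities, and the common
  solutions form a convex set. The second bounding hyperplane passes through the three
  vertices.\<close>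

lemma newton_polyhedron_bounds:
  assumes "p \<in> P" shows "0 \<le> p $ i" "1 \<le> (\<Sum>j\<in>UNIV. p $ j / e j)"
proof -
  define Q :: "(real^3) set" where
    "Q = (\<Inter>i. {p. 0 \<le> axis i 1 \<bullet> p}) \<inter> {p. 1 \<le> (\<chi> j. 1 / real (e j)) \<bullet> p}"
  have Q: "p \<in> Q \<longleftrightarrow> (\<forall>i. 0 \<le> p $ i) \<and> 1 \<le> (\<Sum>j\<in>UNIV. p $ j / e j)" for p
  proof -
    have "axis i 1 \<bullet> p = p $ i" for i by (simp add: inner_axis')
    moreover have "(\<chi> j. 1 / real (e j)) \<bullet> p = (\<Sum>j\<in>UNIV. p $ j / e j)"
      by (simp add: inner_vec_def)
    ultimately show ?thesis by (simp add: Q_def)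
  qed
  have "convex Q" unfolding Q_def
    using convex_halfspace_ge[where 'a = "real^3"] by (intro convex_Int convex_INT) auto
  moreover have "(\<chi> k. of_nat (m $ k)) + v \<in> Q"
    if "m \<in> Poly_Mapping.keys f" "v \<in> orthant" for m v
  proof -
    obtain i where i: "m = axis i (e i)" using \<open>m \<in> _\<close> keys_f by blast
    have "1 = real (m $ i) / e i" using e_pos[of i] by (simp add: i)
    also have "\<dots> \<le> (real (m $ i) + v $ i) / e i"
      using that by (intro divide_right_mono) (auto simp: orthant_def)
    also have "\<dots> \<le> (\<Sum>j\<in>UNIV. (real (m $ j) + v $ j) / e j)"
      using that by (intro member_le_sum) (auto simp: orthant_def)
    finally show ?thesis using that by (simp add: Q orthant_def)
  qed
  then have "(\<Union>m\<in>Poly_Mapping.keys f. {(\<chi> k. of_nat (m $ k)) + v | v. v \<in> orthant}) \<subseteq> Q"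
    by blast
  ultimately have "P \<subseteq> Q"
    unfolding newton_polyhedron_def by (rule hull_minimal[rotated])
  then show "0 \<le> p $ i" "1 \<le> (\<Sum>j\<in>UNIV. p $ j / e j)" using Q assms by blast+
qed

text \<open>On the cone where \<open>vertex i\<close> is minimal, all terms of the second sum are nonnegative.\<close>

lemma inner_eq:
  "u \<bullet> p = e i * u $ i * (\<Sum>j\<in>UNIV. p $ j / e j) + (\<Sum>j\<in>UNIV. (e j * u $ j - e i * u $ i) * (p $ j / e j))"
proof -
  have "u $ j * p $ j = e i * u $ i * (p $ j / e j) + (e j * u $ j - e i * u $ i) * (p $ j / e j)" for j
    using e_pos[of j] by (simp add: field_simps)
  then show ?thesis by (simp add: inner_vec_def sum.distrib sum_distrib_left)
qed

text \<open>Minimality among the vertices suffices: in \<open>inner_eq\<close> the factor of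
  \<open>e i * u $ i\<close> is at least 1 and the remainder is nonnegative on the
  polyhedron.\<close>

lemma vertex_min_face_iff:
  assumes u: "u \<in> orthant"
  shows "vertex i \<in> min_face P u \<longleftrightarrow> (\<forall>j. e i * u $ i \<le> e j * u $ j)"
proof
  assume "vertex i \<in> min_face P u"
  then show "\<forall>j. e i * u $ i \<le> e j * u $ j"
    using vertex_in by (auto simp: min_face_def simp flip: inner_vertex)
next
  assume le: "\<forall>j. e i * u $ i \<le> e j * u $ j"
  have "e i * u $ i \<le> u \<bullet> q" if q: "q \<in> P" for q
  proof -
    have "e i * u $ i * 1 \<le> e i * u $ i * (\<Sum>j\<in>UNIV. q $ j / e j)"
      using newton_polyhedron_bounds(2)[OF q] u by (intro mult_left_mono) (auto simp: orthant_def)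
    moreover have "0 \<le> (\<Sum>j\<in>UNIV. (e j * u $ j - e i * u $ i) * (q $ j / e j))"
      using newton_polyhedron_bounds(1)[OF q] le by (intro sum_nonneg mult_nonneg_nonneg) auto
    ultimately show ?thesis using inner_eq[of u q i] by simp
  qed
  then show "vertex i \<in> min_face P u" by (simp add: min_face_def vertex_in inner_vertex)
qed

section \<open>Covectors whose minimal face is a single vertex\<close>

lemma open_dual_cone_subset: "open_dual_cone i \<subseteq> dual_cone i"
proof
  fix u assume u: "u \<in> open_dual_cone i"
  have "0 \<le> u $ j \<and> e i * u $ i \<le> e j * u $ j" for j
  proof (cases "j = i")
    case False
    then have le: "e i * u $ i < e j * u $ j" and "0 < e i * u $ i"
      using u e_pos by (auto simp: open_dual_cone_def)
    then have "0 < e j * u $ j" by linarith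
    then show ?thesis using le e_pos[of j] by (simp add: zero_less_mult_iff)
  qed (use u in \<open>auto simp: open_dual_cone_def\<close>)
  then show "u \<in> dual_cone i" by (auto simp: dual_cone_def orthant_def)
qed

text \<open>A minimiser attains equality in both estimates: the normalised coordinate sum is 1 and
  each remainder term is 0. Strict inequalities then kill every coordinate except the
  \<open>i\<close>-th, which the sum determines.\<close>

lemma min_face_open_dual_cone:
  assumes u: "u \<in> open_dual_cone i"
  shows "min_face P u = {vertex i}"
proof -
  have orth: "u \<in> orthant" and le: "\<And>j. e i * u $ i \<le> e j * u $ j"
    using u open_dual_cone_subset by (auto simp: dual_cone_def)
  have "p = vertex i" if p: "p \<in> min_face P u" for p
  proof -
    let ?m = "e i * u $ i" and ?s = "\<Sum>j\<in>UNIV. p $ j / e j"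
    let ?r = "\<lambda>j. (e j * u $ j - ?m) * (p $ j / e j)"
    have pP: "p \<in> P" and "u \<bullet> p \<le> u \<bullet> vertex i"
      using p vertex_in by (auto simp: min_face_def)
    then have "?m * ?s + (\<Sum>j\<in>UNIV. ?r j) \<le> ?m" using inner_eq[of u p i] by (simp add: inner_vertex)
    moreover have m: "0 < ?m" using u e_pos by (simp add: open_dual_cone_def)
    then have "?m * 1 \<le> ?m * ?s" using newton_polyhedron_bounds(2)[OF pP] by (intro mult_left_mono) auto
    moreover have r: "0 \<le> ?r j" for j
      using newton_polyhedron_bounds(1)[OF pP] le by (intro mult_nonneg_nonneg) auto
    then have "0 \<le> (\<Sum>j\<in>UNIV. ?r j)" by (rule sum_nonneg)
    ultimately have "?m * ?s = ?m" and "(\<Sum>j\<in>UNIV. ?r j) = 0" by linarith+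
    then have s: "?s = 1" and rj: "?r j = 0" for j
      using m r by (auto simp: sum_nonneg_eq_0_iff simp del: mult_eq_0_iff)
    have pj: "p $ j = 0" if "j \<noteq> i" for j
      using rj[of j] u that e_pos[of j] by (auto simp: open_dual_cone_def)
    then have "?s = (\<Sum>j\<in>UNIV. if j = i then p $ i / e i else 0)" by (intro sum.cong) auto
    then have "p $ i = e i" using s e_pos[of i] by simp
    then show ?thesis using pj by (auto simp: vec_eq_iff vertex_def axis_def)
  qed
  moreover have "vertex i \<in> min_face P u" using le by (simp add: vertex_min_face_iff[OF orth])
  ultimately show ?thesis by blast
qed

text \<open>A covector of the class is minimal at \<open>vertex i\<close> and at no other vertex,
  which makes the inequalities strict.\<close>

lemma min_face_class:
  assumes w: "w \<in> open_dual_cone i"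
  shows "{u \<in> orthant. min_face P u = min_face P w} = open_dual_cone i"
proof (intro equalityI subsetI)
  fix u assume u: "u \<in> open_dual_cone i"
  then have "u \<in> orthant" using open_dual_cone_subset[of i] by (auto simp: dual_cone_def)
  then show "u \<in> {u \<in> orthant. min_face P u = min_face P w}"
    using min_face_open_dual_cone[OF u] min_face_open_dual_cone[OF w] by simp
next
  fix u assume "u \<in> {u \<in> orthant. min_face P u = min_face P w}"
  then have u: "u \<in> orthant" and mf: "min_face P u = {vertex i}"
    using min_face_open_dual_cone[OF w] by auto
  have le: "e i * u $ i \<le> e j * u $ j" for j
    using vertex_min_face_iff[OF u, of i] mf by simp
  have "e i * u $ i < e j * u $ j" if "j \<noteq> i" for j
  proof -
    have "vertex j \<notin> min_face P u" using mf that vertex_eq_iff by simp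
    then obtain k where "e k * u $ k < e j * u $ j"
      using vertex_min_face_iff[OF u] by (auto simp: not_le)
    then show ?thesis using le[of k] by linarith
  qed
  moreover have "u $ i \<noteq> 0"
  proof
    \<comment> \<open>Moving from the vertex along the \<open>i\<close>-th axis would then not
      change the value, so the minimal face would have a second point.\<close>
    assume "u $ i = 0"
    have "axis i 1 \<in> orthant" by (simp add: orthant_def axis_def)
    then have "vertex i + axis i 1 \<in> P" by (rule vertex_plus_in)
    moreover have "u \<bullet> (vertex i + axis i 1) = u \<bullet> vertex i"
      using \<open>u $ i = 0\<close> by (simp add: inner_add_right inner_axis)
    moreover have "vertex i \<in> min_face P u" using mf by simp
    ultimately have "vertex i + axis i 1 \<in> min_face P u" by (simp add: min_face_def)
    then show False using mf by (simp add: axis_eq_0_iff)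
  qed
  ultimately show "u \<in> open_dual_cone i"
    using u by (auto simp: open_dual_cone_def orthant_def order.strict_iff_order)
qed

section \<open>Topology of the dual cones\<close>

lemma open_open_dual_cone: "open (open_dual_cone i)"
proof -
  have "open_dual_cone i = {u. 0 < u $ i} \<inter> (\<Inter>j\<in>-{i}. {u. e i * u $ i < e j * u $ j})"
    by (auto simp: open_dual_cone_def)
  also have "open \<dots>"
    by (intro open_Int open_INT ballI open_Collect_less continuous_intros) auto
  finally show ?thesis .
qed

lemma open_dual_cone_nonempty: "open_dual_cone i \<noteq> {}"
proof -
  \<comment> \<open>The entries give \<open>e j * u $ j\<close> the value \<open>e i + 1\<close> for
    \<open>j \<noteq> i\<close>, just above \<open>e i\<close>.\<close>
  have "(\<chi> j. if j = i then 1 else (e i + 1) / e j) \<in> open_dual_cone i"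
    using e_pos by (simp add: open_dual_cone_def)
  then show ?thesis by blast
qed

text \<open>Adding a small positive multiple of a fixed covector of the open cone makes the
  inequalities strict, so every point of the closed cone is a limit of points of the open
  one.\<close>

lemma closure_open_dual_cone: "closure (open_dual_cone i) = dual_cone i"
proof
  have "closed (dual_cone i)"
  proof -
    have "dual_cone i = orthant \<inter> {u. \<forall>j. e i * u $ i \<le> e j * u $ j}" by (auto simp: dual_cone_def)
    also have "closed \<dots>"
      by (intro closed_Int closed_orthant closed_Collect_all closed_Collect_le continuous_intros)
    finally show ?thesis .
  qed
  then show "closure (open_dual_cone i) \<subseteq> dual_cone i"
    using open_dual_cone_subset by (intro closure_minimal)
  show "dual_cone i \<subseteq> closure (open_dual_cone i)"
  proof
    fix u assume u: "u \<in> dual_cone i"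
    obtain w where w: "w \<in> open_dual_cone i" using open_dual_cone_nonempty by blast
    have "u + t *\<^sub>R w \<in> open_dual_cone i" if "0 < t" for t
    proof -
      have "0 < u $ i + t * w $ i"
        using u w that by (intro add_nonneg_pos) (auto simp: dual_cone_def orthant_def open_dual_cone_def)
      moreover have "e i * (u $ i + t * w $ i) < e j * (u $ j + t * w $ j)" if "j \<noteq> i" for j
      proof -
        have "e i * u $ i \<le> e j * u $ j" using u by (simp add: dual_cone_def)
        moreover have "t * (e i * w $ i) < t * (e j * w $ j)"
          using w that \<open>0 < t\<close> by (intro mult_strict_left_mono) (auto simp: open_dual_cone_def)
        ultimately show ?thesis by (simp add: algebra_simps)
      qed
      ultimately show ?thesis by (simp add: open_dual_cone_def)
    qed
    then have "\<forall>n. u + (1 / real (Suc n)) *\<^sub>R w \<in> open_dual_cone i" by simp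
    moreover have "(\<lambda>n. u + (1 / real (Suc n)) *\<^sub>R w) \<longlonglongrightarrow> u + 0 *\<^sub>R w"
      by (intro tendsto_intros LIMSEQ_Suc[OF lim_1_over_n])
    ultimately show "u \<in> closure (open_dual_cone i)" unfolding closure_sequential by auto
  qed
qed

section \<open>Members and support of the dual fan\<close>

lemma dual_cone_in_fan: "dual_cone i \<in> newton_dual_fan f"
proof -
  obtain w where w: "w \<in> open_dual_cone i" using open_dual_cone_nonempty by blast
  then have "w \<in> orthant" using open_dual_cone_subset by (auto simp: dual_cone_def)
  moreover have "dual_cone i = closure {u \<in> orthant. min_face P u = min_face P w}"
    by (simp only: min_face_class[OF w] closure_open_dual_cone)
  ultimately show ?thesis unfolding newton_dual_fan_def by blast
qed

text \<open>An open set meeting a closure meets the set itself, so the class behind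
  \<open>\<sigma>\<close> shares a point with the open cone and equals it. One interior covector
  thus identifies a member without a classification of the fan.\<close>

lemma fan_member_eq_dual_cone:
  assumes "\<sigma> \<in> newton_dual_fan f" "w \<in> \<sigma>" "w \<in> open_dual_cone i"
  shows "\<sigma> = dual_cone i"
proof -
  obtain w0 where \<sigma>: "\<sigma> = closure {u \<in> orthant. min_face P u = min_face P w0}"
    using assms(1) unfolding newton_dual_fan_def by blast
  have "open_dual_cone i \<inter> {u \<in> orthant. min_face P u = min_face P w0} \<noteq> {}"
    using assms(2,3) open_Int_closure_eq_empty[OF open_open_dual_cone] unfolding \<sigma> by blast
  then obtain u where u: "u \<in> open_dual_cone i" "min_face P u = min_face P w0" by blast
  then show ?thesis using min_face_class[OF u(1)] \<sigma> closure_open_dual_cone by simp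
qed

lemma Union_newton_dual_fan: "\<Union>(newton_dual_fan f) = orthant"
proof
  have "closure {u \<in> orthant. min_face P u = min_face P w} \<subseteq> orthant" for w
    by (intro closure_minimal closed_orthant) auto
  then show "\<Union>(newton_dual_fan f) \<subseteq> orthant" unfolding newton_dual_fan_def by blast
  show "orthant \<subseteq> \<Union>(newton_dual_fan f)"
  proof
    fix w :: "real^3" assume w: "w \<in> orthant"
    then have "w \<in> closure {u \<in> orthant. min_face P u = min_face P w}"
      by (intro closure_subset[THEN subsetD]) auto
    then show "w \<in> \<Union>(newton_dual_fan f)" using w unfolding newton_dual_fan_def by blast
  qed
qed

lemma convex_cone_dual_cone: "convex_cone (dual_cone i)"
  unfolding convex_cone_iff
proof (intro conjI ballI allI impI)
  show "0 \<in> dual_cone i" by (simp add: dual_cone_def orthant_def)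
next
  fix x y assume "x \<in> dual_cone i" "y \<in> dual_cone i"
  then show "x + y \<in> dual_cone i"
    by (auto simp: dual_cone_def orthant_def distrib_left add_mono)
next
  fix x and c :: real assume x: "x \<in> dual_cone i" "0 \<le> c"
  then have "c * (e i * x $ i) \<le> c * (e j * x $ j)" for j
    by (intro mult_left_mono) (auto simp: dual_cone_def)
  then show "c *\<^sub>R x \<in> dual_cone i"
    using x by (simp add: dual_cone_def orthant_def mult.left_commute)
qed

end

section \<open>The support of the E8 polynomial\<close>

lemma axis_add: "axis i a + axis i b = axis i (a + b :: 'a::monoid_add)"
  by (simp add: vec_eq_iff axis_def)

lemma pvar_power: "pvar i ^ n = Poly_Mapping.single (axis i n) 1"
proof (induction n)
  case 0
  have ax0: "axis i 0 = (0 :: nat^3)" by (simp add: vec_eq_iff axis_def)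
  show ?case unfolding ax0 by (simp only: power_0 single_one)
next
  case (Suc n)
  have "pvar i ^ Suc n = pvar i * Poly_Mapping.single (axis i n) 1" by (simp only: power_Suc Suc)
  also have "\<dots> = Poly_Mapping.single (axis i 1) 1 * Poly_Mapping.single (axis i n) 1"
    by (simp only: pvar_def)
  also have "\<dots> = Poly_Mapping.single (axis i 1 + axis i n) (1 * 1)" by (rule mult_single)
  also have "\<dots> = Poly_Mapping.single (axis i (Suc n)) 1" by (simp only: axis_add mult_1 plus_1_eq_Suc)
  finally show ?case .
qed

definition exponents_E8 :: "3 \<Rightarrow> nat" where
  "exponents_E8 i = (if i = 1 then 5 else if i = 2 then 3 else 2)"

lemma exponents_E8_simps [simp]:
  "exponents_E8 1 = 5" "exponents_E8 2 = 3" "exponents_E8 3 = 2"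
  by (simp_all add: exponents_E8_def)

lemma keys_f_E8: "Poly_Mapping.keys f_E8 = range (\<lambda>i. axis i (exponents_E8 i))"
proof -
  have "Poly_Mapping.keys f_E8 = {axis 1 5, axis 2 3, axis 3 2}"
    by (auto simp: f_E8_def pvar_power in_keys_iff lookup_add lookup_single axis_eq_axis when_def
        split: if_splits)
  then show ?thesis by (simp add: UNIV_3)
qed

interpretation E8: brieskorn_pham f_E8 exponents_E8
proof
  show "Poly_Mapping.keys f_E8 = range (\<lambda>i. axis i (exponents_E8 i))" by (rule keys_f_E8)
  show "0 < exponents_E8 i" for i by (simp add: exponents_E8_def)
qed

section \<open>The resolution of the $E_8$ singularity\<close>

type_synonym ivec = "int \<times> int \<times> int"

text \<open>A version of \<open>star\<close> that can be evaluated; the inner lists stand for sets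
  of generators.\<close>

definition star_list :: "ivec list \<Rightarrow> ivec list list \<Rightarrow> ivec list list" where
  "star_list \<tau> Fs = concat (map (\<lambda>F. if set \<tau> \<subseteq> set F
     then map (\<lambda>t. sum_list \<tau> # removeAll t F) \<tau> else [F]) Fs)"

fun emb :: "ivec \<Rightarrow> real^3" where
  "emb (a, b, c) = vector [of_int a, of_int b, of_int c]"

lemma emb_add: "emb (x + y) = emb x + emb y"
  by (cases x; cases y) (simp add: vec_eq_iff forall_3)

lemma emb_zero: "emb 0 = 0"
  by (simp add: zero_prod_def vec_eq_iff forall_3)

lemma inj_emb: "inj emb"
  by (rule injI) (auto simp: vec_eq_iff forall_3)

lemma emb_sum_list: "emb (sum_list xs) = sum_list (map emb xs)"
  by (induction xs) (simp_all add: emb_add emb_zero)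

definition facets :: "ivec list list \<Rightarrow> (real^3) set set" where
  "facets Fs = (\<lambda>F. emb ` set F) ` set Fs"

text \<open>Inclusion and difference pass through the injective map \<open>emb\<close>, and a list
  without repetitions has the same sum as its set.\<close>

lemma facets_star_list:
  assumes "distinct \<tau>"
  shows "facets (star_list \<tau> Fs) = star (emb ` set \<tau>) (facets Fs)"
proof -
  have sum: "\<Sum>(emb ` set \<tau>) = emb (sum_list \<tau>)"
    using assms inj_emb
    by (simp add: emb_sum_list sum_list_distinct_conv_sum_set sum.reindex inj_on_subset[OF inj_emb])
  have sub: "emb ` set \<tau> \<subseteq> emb ` set F \<longleftrightarrow> set \<tau> \<subseteq> set F" for F
    using inj_emb by (rule inj_image_subset_iff)
  have diff: "emb ` (set F - {t}) = emb ` set F - {emb t}" for F t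
    using inj_emb by (simp add: image_set_diff)
  have "facets (star_list \<tau> Fs) =
    (\<Union>F\<in>set Fs. if set \<tau> \<subseteq> set F then (\<lambda>t. emb ` insert (sum_list \<tau>) (set F - {t})) ` set \<tau>
      else {emb ` set F})"
    unfolding facets_def star_list_def set_concat set_map image_UN image_image
    by (intro SUP_cong refl) (simp add: image_image)
  also have "\<dots> = star (emb ` set \<tau>) (facets Fs)"
    unfolding star_eq_UN facets_def image_image sum sub
    by (intro SUP_cong refl) (simp add: image_image diff)
  finally show ?thesis .
qed

lemma triangulation_fold_star_list:
  assumes "triangulates (facets Fs) X" "unimodular (facets Fs)"
    and "\<forall>\<tau>\<in>set \<tau>s. distinct \<tau> \<and> 2 \<le> length \<tau>"
  shows "triangulates (facets (fold star_list \<tau>s Fs)) X \<and> unimodular (facets (fold star_list \<tau>s Fs))"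
  using assms
proof (induction \<tau>s arbitrary: Fs)
  case (Cons \<tau> \<tau>s)
  then have \<tau>: "distinct \<tau>" "2 \<le> card (emb ` set \<tau>)"
    by (auto simp: card_image inj_on_subset[OF inj_emb] distinct_card)
  have "triangulates (facets (star_list \<tau> Fs)) X" "unimodular (facets (star_list \<tau> Fs))"
    using Cons.prems \<tau> by (auto simp only: facets_star_list intro: triangulates_star unimodular_star)
  then show ?case using Cons.IH Cons.prems(3) by simp
qed simp

text \<open>Found by computer search among the sequences of star subdivisions whose new rays all lie in
  \<open>W_E8\<close>.\<close>

definition E8_centers :: "ivec list list" where
  "E8_centers = [[(0,0,1),(0,1,0),(1,0,0)], [(0,0,1),(0,1,0),(1,1,1)], [(0,0,1),(1,1,1)],
     [(0,0,1),(1,1,2),(1,2,2)], [(1,1,1),(1,1,2)], [(0,0,1),(1,2,2),(2,3,5)],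
     [(1,1,2),(1,2,2)], [(1,2,2),(2,3,5),(3,5,8)], [(2,3,4),(2,3,5)], [(1,2,2),(3,5,8)],
     [(1,1,2),(2,3,4)], [(1,2,2),(2,3,5)], [(1,2,2),(4,6,9)], [(1,1,2),(4,6,9)],
     [(0,0,1),(1,2,2)], [(2,3,5),(3,5,7)], [(0,0,1),(1,2,3),(4,7,10)], [(1,2,2),(1,2,3)],
     [(1,2,3),(4,7,10)]]"

definition E8_facets :: "ivec list list" where
  "E8_facets = fold star_list E8_centers [[(1,0,0),(0,1,0),(0,0,1)]]"

text \<open>\<open>5*a\<close>, \<open>3*b\<close> and \<open>2*c\<close> are the weights of x^5,
  y^3 and z^2: on each maximal cone one monomial is of least weight at all generators.\<close>

lemma E8_facets_in_cones:
  "\<forall>F\<in>set E8_facets. (\<forall>(a,b,c)\<in>set F. 5*a \<le> 3*b \<and> 5*a \<le> 2*c) \<or>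
     (\<forall>(a,b,c)\<in>set F. 3*b \<le> 5*a \<and> 3*b \<le> 2*c) \<or> (\<forall>(a,b,c)\<in>set F. 2*c \<le> 5*a \<and> 2*c \<le> 3*b)"
  by code_simp

text \<open>(4,6,8) and (6,10,14) cannot occur, since generators of a unimodular cone are
  primitive.\<close>

lemma E8_facets_vertices:
  "\<Union>(set ` set E8_facets) = {(1,0,0), (0,1,0), (0,0,1), (1,1,1),(1,1,2),(1,2,2),(1,2,3),(2,2,3),
     (2,3,4),(2,3,5),(2,4,5),(3,4,6),(3,5,7),(3,5,8),(4,6,9),(4,7,10),(5,7,11),(5,8,11),(5,8,12),
     (5,9,13),(5,9,14),(6,10,15)}"
  by code_simp

section \<open>The E8 triangulation and its rays\<close>

lemma emb_axis: "emb (1,0,0) = axis 1 1" "emb (0,1,0) = axis 2 1" "emb (0,0,1) = axis 3 1"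
  by (simp_all add: vec_eq_iff forall_3 axis_def)

lemma E8_triangulation: "triangulates (facets E8_facets) orthant" "unimodular (facets E8_facets)"
proof -
  have "facets [[(1,0,0),(0,1,0),(0,0,1)]] = {{axis 1 1, axis 2 1, axis 3 1}}"
    by (simp only: facets_def list.set image_insert image_empty emb_axis)
  moreover have "\<forall>\<tau>\<in>set E8_centers. distinct \<tau> \<and> 2 \<le> length \<tau>" by code_simp
  ultimately show "triangulates (facets E8_facets) orthant" "unimodular (facets E8_facets)"
    using triangulation_fold_star_list[of "[[(1,0,0),(0,1,0),(0,0,1)]]" orthant E8_centers]
      orthant_triangulation by (simp_all only: E8_facets_def)
qed

lemma E8_rays:
  "rays (simplicial_cones (facets E8_facets)) =
     (\<lambda>w. convex_cone hull {w}) ` ({axis 1 1, axis 2 1, axis 3 1} \<union> W_E8)"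
proof -
  define C :: "real^3 \<Rightarrow> (real^3) set" where "C = (\<lambda>w. convex_cone hull {w})"
  \<comment> \<open>The two vectors of \<open>W_E8\<close> that are not generators are twice
    generators, so their rays are already present.\<close>
  have "vector [4,6,8] = 2 *\<^sub>R (vector [2,3,4] :: real^3)"
    "vector [6,10,14] = 2 *\<^sub>R (vector [3,5,7] :: real^3)"
    by (simp_all add: vec_eq_iff forall_3)
  then have C: "C (vector [4,6,8]) = C (vector [2,3,4])" "C (vector [6,10,14]) = C (vector [3,5,7])"
    unfolding C_def by (simp_all only: convex_cone_hull_scaled zero_less_numeral)
  have "\<Union>(facets E8_facets) = emb ` \<Union>(set ` set E8_facets)" by (auto simp: facets_def)
  then have "rays (simplicial_cones (facets E8_facets)) = C ` emb ` \<Union>(set ` set E8_facets)"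
    by (simp add: rays_simplicial_cones[OF E8_triangulation(2)] C_def)
  \<comment> \<open>After rewriting by the facts \<open>C\<close>, both sides list the same cones up
    to order and repetition.\<close>
  also have "\<dots> = C ` ({axis 1 1, axis 2 1, axis 3 1} \<union> W_E8)"
    unfolding E8_facets_vertices image_insert image_empty emb_axis
    unfolding emb.simps W_E8_def of_int_1 of_int_numeral image_Un image_insert image_empty C
    by (rule subset_antisym) (simp_all only: insert_subset empty_subsetI insert_iff Un_insert_left Un_empty_left
        simp_thms)
  finally show ?thesis by (simp only: C_def)
qed

section \<open>Position of the cones in the dual fan\<close>

lemma emb_in_dual_cone:
  "emb (a,b,c) \<in> E8.dual_cone i \<longleftrightarrow> 0 \<le> a \<and> 0 \<le> b \<and> 0 \<le> c \<and>
     (\<forall>j. exponents_E8 i * (emb (a,b,c) $ i) \<le> exponents_E8 j * (emb (a,b,c) $ j))"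
  by (simp add: E8.dual_cone_def orthant_def forall_3 conj_ac)

lemma E8_nonneg: "\<forall>F\<in>set E8_facets. \<forall>(a,b,c)\<in>set F. 0 \<le> a \<and> 0 \<le> b \<and> 0 \<le> c"
  by code_simp

text \<open>Coordinates are nonnegative, so the integer inequalities checked on the lists are all
  that membership in a dual cone demands.\<close>

lemma E8_facet_subset_dual_cone:
  assumes "S \<in> facets E8_facets"
  shows "\<exists>i. S \<subseteq> E8.dual_cone i"
proof -
  obtain F where F: "F \<in> set E8_facets" "S = emb ` set F" using assms by (auto simp: facets_def)
  have nonneg: "0 \<le> a \<and> 0 \<le> b \<and> 0 \<le> c" if "(a,b,c) \<in> set F" for a b c
    using E8_nonneg F(1) that by fastforce
  have mem: "emb (a,b,c) \<in> E8.dual_cone 1 \<longleftrightarrow> 5*a \<le> 3*b \<and> 5*a \<le> 2*c"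
    "emb (a,b,c) \<in> E8.dual_cone 2 \<longleftrightarrow> 3*b \<le> 5*a \<and> 3*b \<le> 2*c"
    "emb (a,b,c) \<in> E8.dual_cone 3 \<longleftrightarrow> 2*c \<le> 5*a \<and> 2*c \<le> 3*b" if "(a,b,c) \<in> set F" for a b c
    using nonneg[OF that] unfolding emb_in_dual_cone by (simp_all add: forall_3) linarith+
  show ?thesis
    using E8_facets_in_cones[rule_format, OF F(1)]
  proof (elim disjE)
    assume "\<forall>(a,b,c)\<in>set F. 5*a \<le> 3*b \<and> 5*a \<le> 2*c"
    then have "S \<subseteq> E8.dual_cone 1" using F(2) mem(1) by fastforce
    then show ?thesis by blast
  next
    assume "\<forall>(a,b,c)\<in>set F. 3*b \<le> 5*a \<and> 3*b \<le> 2*c"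
    then have "S \<subseteq> E8.dual_cone 2" using F(2) mem(2) by fastforce
    then show ?thesis by blast
  next
    assume "\<forall>(a,b,c)\<in>set F. 2*c \<le> 5*a \<and> 2*c \<le> 3*b"
    then have "S \<subseteq> E8.dual_cone 3" using F(2) mem(3) by fastforce
    then show ?thesis by blast
  qed
qed

text \<open>Dual cones are convex cones, so their containing the generators of a cone already gives
  containment of the cone.\<close>

lemma E8_regular_subdivision:
  "regular_subdivision (simplicial_cones (facets E8_facets)) (newton_dual_fan f_E8)"
  unfolding regular_subdivision_def subdivides_def
proof (intro conjI ballI)
  have "E8_facets \<noteq> []" by code_simp
  then show "regular_fan (simplicial_cones (facets E8_facets))"
    by (intro regular_fan_simplicial_cones E8_triangulation) (simp add: facets_def)
  show "\<Union>(simplicial_cones (facets E8_facets)) = \<Union>(newton_dual_fan f_E8)"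
    using Union_simplicial_cones[OF E8_triangulation(1)] E8.Union_newton_dual_fan by simp
  fix \<sigma> assume "\<sigma> \<in> simplicial_cones (facets E8_facets)"
  then obtain S T where S: "\<sigma> = convex_cone hull S" "S \<subseteq> T" "T \<in> facets E8_facets"
    by (auto simp: simplicial_cones_def)
  obtain i where "T \<subseteq> E8.dual_cone i" using E8_facet_subset_dual_cone[OF S(3)] by blast
  then have "\<sigma> \<subseteq> E8.dual_cone i"
    unfolding S(1) using S(2) by (intro hull_minimal E8.convex_cone_dual_cone) auto
  then show "\<exists>\<tau>\<in>newton_dual_fan f_E8. \<sigma> \<subseteq> \<tau>" using E8.dual_cone_in_fan by blast
qed

section \<open>The ray through (5,9,14)\<close>

lemma E8_not_minimal:
  assumes "convex_cone hull {vector [5,9,14]} \<in> rays \<Sigma>"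
  shows "\<not> minimal_subdivision \<Sigma> (newton_dual_fan f_E8)"
proof
  define w :: "real^3" where "w = vector [5,9,14]"
  \<comment> \<open>The weights of x^5, y^3, z^2 are 25, 27, 28 at (5,9,14), then 0, 0, 2 at (0,0,1)
    and 25, 27, 26 at (5,9,13); x^5 is minimal each time, strictly at the first.\<close>
  have open_w: "t *\<^sub>R w \<in> E8.open_dual_cone 1" if "0 < t" for t
    using that by (simp add: E8.open_dual_cone_def forall_3 w_def)
  have e3: "t *\<^sub>R axis 3 1 \<in> E8.dual_cone 1" if "0 \<le> t" for t
    using that by (simp add: E8.dual_cone_def orthant_def forall_3 axis_def)
  have u: "t *\<^sub>R vector [5,9,13] \<in> E8.dual_cone 1" if "0 \<le> t" for t
    using that by (simp add: E8.dual_cone_def orthant_def forall_3)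
  assume "minimal_subdivision \<Sigma> (newton_dual_fan f_E8)"
  then consider "convex_cone hull {w} \<in> newton_dual_fan f_E8"
    | \<sigma> g where "\<sigma> \<in> newton_dual_fan f_E8" "g \<in> irreducible_points \<sigma>" "convex_cone hull {w} = convex_cone hull {g}"
    using assms unfolding minimal_subdivision_def w_def rays_def by blast
  then show False
  proof cases
    case 1
    have "w \<in> convex_cone hull {w}" by (simp add: hull_inc)
    \<comment> \<open>A member of the fan through such a covector is the full dual cone, which
      contains \<open>axis 3 1\<close>, a vector off the ray.\<close>
    then have "convex_cone hull {w} = E8.dual_cone 1"
      using E8.fan_member_eq_dual_cone[OF 1] open_w[of 1] by simp
    then have "axis 3 1 \<in> convex_cone hull {w}" using e3[of 1] by simp
    then show False by (auto simp: convex_cone_hull_singleton w_def vec_eq_iff forall_3 axis_def)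
  next
    case 2
    have g: "g \<in> \<sigma>" "g \<in> int_lattice" "g \<noteq> 0"
      using 2(2) by (auto simp: irreducible_points_def)
    have "g \<in> convex_cone hull {w}" using 2(3) by (simp add: hull_inc)
    \<comment> \<open>\<open>g\<close> is only known to span the ray of \<open>w\<close>, so every
      positive multiple must be excluded.\<close>
    then obtain t where t: "g = t *\<^sub>R w" "0 \<le> t" by (auto simp: convex_cone_hull_singleton)
    then have "0 < t" using g(3) by (cases "t = 0") auto
    then have \<sigma>: "\<sigma> = E8.dual_cone 1" using E8.fan_member_eq_dual_cone[OF 2(1) g(1)] open_w t(1) by simp
    have "g $ 1 \<in> \<int>" "g $ 2 \<in> \<int>" using g(2) by (simp_all add: int_lattice_def)
    \<comment> \<open>As 2 times 5 minus 9 is 1, this integer combination of coordinates isolates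
      \<open>t\<close>.\<close>
    then have "2 * (g $ 1) - g $ 2 \<in> \<int>" by (intro Ints_diff Ints_mult) auto
    also have "2 * (g $ 1) - g $ 2 = t" by (simp add: t(1) w_def)
    finally have int: "t \<in> \<int>" .
    \<comment> \<open>The decomposition of (5,9,14) scaled by \<open>t\<close>; integrality of
      \<open>t\<close> makes both summands lattice points.\<close>
    define x y :: "real^3" where "x = t *\<^sub>R axis 3 1" and "y = t *\<^sub>R vector [5,9,13]"
    have "x \<in> int_lattice" "y \<in> int_lattice"
      using int by (auto simp: int_lattice_def forall_3 x_def y_def axis_def intro!: Ints_mult)
    moreover have "x \<in> \<sigma>" "y \<in> \<sigma>" using e3 u t(2) by (auto simp: \<sigma> x_def y_def)
    moreover have "g = x + y" by (simp add: t(1) w_def x_def y_def vec_eq_iff forall_3 axis_def)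
    ultimately have "x = 0 \<or> y = 0" using 2(2) by (auto simp: irreducible_points_def)
    then show False using \<open>0 < t\<close> by (auto simp: x_def y_def vec_eq_iff forall_3 axis_def)
  qed
qed

theorem proposition4p7:
  shows "(\<exists>\<Sigma>. regular_subdivision \<Sigma> (newton_dual_fan f_E8) \<and>
              rays \<Sigma> = (\<lambda>w. convex_cone hull {w}) ` ({axis 1 1, axis 2 1, axis 3 1} \<union> W_E8)) \<and>
         (\<forall>\<Sigma>. regular_subdivision \<Sigma> (newton_dual_fan f_E8) \<and>
              rays \<Sigma> = (\<lambda>w. convex_cone hull {w}) ` ({axis 1 1, axis 2 1, axis 3 1} \<union> W_E8) \<longrightarrow>
              \<not> minimal_subdivision \<Sigma> (newton_dual_fan f_E8))"
proof (intro conjI allI impI)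
  show "\<exists>\<Sigma>. regular_subdivision \<Sigma> (newton_dual_fan f_E8) \<and>
              rays \<Sigma> = (\<lambda>w. convex_cone hull {w}) ` ({axis 1 1, axis 2 1, axis 3 1} \<union> W_E8)"
    using E8_regular_subdivision E8_rays by blast
  fix \<Sigma> assume "regular_subdivision \<Sigma> (newton_dual_fan f_E8) \<and>
    rays \<Sigma> = (\<lambda>w. convex_cone hull {w}) ` ({axis 1 1, axis 2 1, axis 3 1} \<union> W_E8)"
  then have rays: "rays \<Sigma> = (\<lambda>w. convex_cone hull {w}) ` ({axis 1 1, axis 2 1, axis 3 1} \<union> W_E8)" by blast
  \<comment> \<open>Minimality constrains each ray separately, so this ray refutes it for every
    \<Sigma> with the given rays.\<close>
  have "vector [5,9,14] \<in> W_E8" by (simp add: W_E8_def)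
  then have "convex_cone hull {vector [5,9,14]} \<in> rays \<Sigma>" unfolding rays by blast
  then show "\<not> minimal_subdivision \<Sigma> (newton_dual_fan f_E8)" by (rule E8_not_minimal)
qed

end
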